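(* Suppose that $Z_1,\ldots,Z_n$ form a random sample (i.i.d.) from the distribution with probability density function $$f(z\mid\theta)=\begin{cases}\dfrac{\theta}{(1-\theta)z^2}, & \theta\le z\le 1,\\[2mm] 0,&\text{otherwise,}\end{cases}$$ where $\theta$, $0<\theta<1$, is unknown. Then the maximum likelihood estimator of $\theta$ is $$\hat\theta=Z_{(1)},\qquad Z_{(1)}=\min(Z_1,\ldots,Z_n).$$
   Context: The likelihood function is $\ell(\theta)=\left(\frac{\theta}{1-\theta}\right)^n\frac{1}{\prod_{i=1}^n z_i^2}$ if $\theta\le z_i\le 1$ for all $i=1,\ldots,n$, and $\ell(\theta)=0$ otherwise; the maximum likelihood estimator is the value of $\theta$ maximizing $\ell$. *)

theory Defs
  imports "HOL-Probability.Probability"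
begin

text \<open>The density \<open>f(z | \<theta>)\<close>; only meant for \<open>0 < \<theta> < 1\<close>.\<close>

definition pareto_like_density :: "real \<Rightarrow> real \<Rightarrow> real" where
  "pareto_like_density \<theta> z =
     (if \<theta> \<le> z \<and> z \<le> 1 then \<theta> / ((1 - \<theta>) * z\<^sup>2) else 0)"

text \<open>The likelihood of the observations \<open>z 1, \<dots>, z n\<close>, as a function of the parameter: their
  joint density under independent sampling from \<open>f \<theta>\<close>.\<close>

definition likelihood :: "(real \<Rightarrow> real \<Rightarrow> real) \<Rightarrow> nat \<Rightarrow> (nat \<Rightarrow> real) \<Rightarrow> real \<Rightarrow> real" where
  "likelihood f n z \<theta> = (\<Prod>i=1..n. f \<theta> (z i))"

lemma likelihood_pareto_like_density:
  "likelihood pareto_like_density n z \<theta> =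
     (if \<forall>i\<in>{1..n}. \<theta> \<le> z i \<and> z i \<le> 1
      then (\<theta> / (1 - \<theta>)) ^ n * (1 / (\<Prod>i=1..n. (z i)\<^sup>2)) else 0)"
proof (cases "\<forall>i\<in>{1..n}. \<theta> \<le> z i \<and> z i \<le> 1")
  case True
  then have "likelihood pareto_like_density n z \<theta> = (\<Prod>i=1..n. \<theta> / (1 - \<theta>) * (1 / (z i)\<^sup>2))"
    unfolding likelihood_def by (intro prod.cong) (auto simp: pareto_like_density_def)
  also have "\<dots> = (\<theta> / (1 - \<theta>)) ^ n * (1 / (\<Prod>i=1..n. (z i)\<^sup>2))"
    by (simp add: prod.distrib prod_dividef power_divide)
  finally show ?thesis
    using True by simp
next
  case False
  then show ?thesis
    unfolding likelihood_def
    by (auto simp: pareto_like_density_def intro!: prod_zero)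
qed

text \<open>\<open>t\<close> is the maximum likelihood estimate over the parameter space \<open>\<Theta>\<close> for the observations
  \<open>z 1, \<dots>, z n\<close>: the maximum of the likelihood over \<open>\<Theta>\<close> is attained at \<open>t\<close> and nowhere else.\<close>

definition is_mle ::
    "(real \<Rightarrow> real \<Rightarrow> real) \<Rightarrow> real set \<Rightarrow> nat \<Rightarrow> (nat \<Rightarrow> real) \<Rightarrow> real \<Rightarrow> bool" where
  "is_mle f \<Theta> n z t \<longleftrightarrow>
     (\<forall>\<theta>. is_arg_max (likelihood f n z) (\<lambda>\<theta>. \<theta> \<in> \<Theta>) \<theta> \<longleftrightarrow> \<theta> = t)"

end

theory Submission
  imports Defs
begin

text \<open>Almost surely all observations lie in the open interval \<open>(0, 1)\<close>, since the density is
  supported on \<open>[\<theta>, 1]\<close> and the endpoint \<open>1\<close> is a null set; on the exceptional event that all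
  observations equal \<open>1\<close>, the supremum of the likelihood over \<open>(0, 1)\<close> is not attained. For
  observations in \<open>(0, 1)\<close> the likelihood is a positive multiple of \<open>(\<theta> / (1 - \<theta>)) ^ n\<close>, hence
  strictly increasing, up to the sample minimum, and it vanishes beyond.\<close>

text \<open>Both denominators are positive, and after cross-multiplication the \<open>s * t\<close>
  terms cancel, leaving \<open>s < t\<close>.\<close>

lemma odds_less:
  fixes s t :: real
  assumes "s < t" "t < 1"
  shows "s / (1 - s) < t / (1 - t)"
  using assms by (simp add: divide_simps algebra_simps)

lemma likelihood_pareto_like_density_pos:
  assumes "\<And>i. i \<in> {1..n} \<Longrightarrow> t \<le> z i \<and> z i \<le> 1" and "0 < t" "t < 1"
  shows "0 < likelihood pareto_like_density n z t"
  unfolding likelihood_def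
proof (intro prod_pos ballI)
  fix i assume "i \<in> {1..n}"
  then have "t \<le> z i" "z i \<le> 1"
    using assms(1) by auto
  then show "0 < pareto_like_density t (z i)"
    using assms(2,3) by (simp add: pareto_like_density_def)
qed

lemma likelihood_pareto_like_density_less_Min:
  assumes "1 \<le> n" and z: "\<And>i. i \<in> {1..n} \<Longrightarrow> 0 < z i \<and> z i < 1"
    and s: "0 < s" "s \<noteq> Min (z ` {1..n})"
  shows "likelihood pareto_like_density n z s
           < likelihood pareto_like_density n z (Min (z ` {1..n}))"
proof -
  let ?m = "Min (z ` {1..n})"
  have "?m \<in> z ` {1..n}"
    using \<open>1 \<le> n\<close> by (intro Min_in) auto
  then have m: "0 < ?m" "?m < 1"
    using z by auto
  have m_le: "?m \<le> z i \<and> z i \<le> 1" if "i \<in> {1..n}" for i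
    using that z[OF that] by simp
  have pos: "0 < likelihood pareto_like_density n z ?m"
    using likelihood_pareto_like_density_pos[OF m_le m] by simp
  show ?thesis
  proof (cases "s < ?m")
    case True
    have le: "s \<le> z i \<and> z i \<le> 1" if "i \<in> {1..n}" for i
      using m_le[OF that] True by linarith
    \<comment> \<open>The power preserves strictness because the exponent is positive
      (\<open>1 \<le> n\<close>) and the smaller odds are nonnegative.\<close>
    have "(s / (1 - s)) ^ n < (?m / (1 - ?m)) ^ n"
      using odds_less[OF True m(2)] \<open>0 < s\<close> \<open>1 \<le> n\<close> less_trans[OF True m(2)]
      by (intro power_strict_mono divide_nonneg_pos) linarith+
    moreover have "0 < 1 / (\<Prod>i=1..n. (z i)\<^sup>2)"
      using z by (force intro!: divide_pos_pos prod_pos)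
    ultimately show ?thesis
      unfolding likelihood_pareto_like_density using le m_le by (simp add: divide_strict_right_mono)
  next
    case False
    \<comment> \<open>Here \<open>s > ?m\<close>, so an observation attaining the minimum lies below
      \<open>s\<close>, outside the support.\<close>
    then have "\<not> (\<forall>i\<in>{1..n}. s \<le> z i \<and> z i \<le> 1)"
      using \<open>?m \<in> z ` {1..n}\<close> s(2) by fastforce
    then have "likelihood pareto_like_density n z s = 0"
      unfolding likelihood_pareto_like_density by (simp only: if_False)
    then show ?thesis
      using pos by simp
  qed
qed

lemma is_mle_pareto_like_density_Min:
  assumes "1 \<le> n" and z: "\<And>i. i \<in> {1..n} \<Longrightarrow> 0 < z i \<and> z i < 1"
  shows "is_mle pareto_like_density {0<..<1} n z (Min (z ` {1..n}))"
proof -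
  let ?m = "Min (z ` {1..n})"
  have "?m \<in> z ` {1..n}"
    using \<open>1 \<le> n\<close> by (intro Min_in) auto
  then have "?m \<in> {0<..<1}"
    using z by auto
  moreover have "likelihood pareto_like_density n z s < likelihood pareto_like_density n z ?m"
    if "s \<in> {0<..<1}" "s \<noteq> ?m" for s
    using likelihood_pareto_like_density_less_Min[OF assms] that by simp
  ultimately show ?thesis
    \<comment> \<open>Strict dominance over every other admissible parameter gives both that
      \<open>?m\<close> is a maximizer and that it is the only one.\<close>
    unfolding is_mle_def is_arg_max_def by (metis order_less_asym order_less_irrefl)
qed

lemma (in prob_space) AE_pareto_like_density_interior:
  assumes X: "distributed M lborel X (\<lambda>z. ennreal (pareto_like_density \<theta> z))" and "0 < \<theta>"
  shows "AE \<omega> in M. 0 < X \<omega> \<and> X \<omega> < 1"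
proof -
  have "AE z in lborel. z \<noteq> (1::real)"
    by (rule AE_lborel_singleton)
  then have "AE z in lborel. 0 < ennreal (pareto_like_density \<theta> z) \<longrightarrow> 0 < z \<and> z < 1"
    by eventually_elim (use \<open>0 < \<theta>\<close> in \<open>auto simp: pareto_like_density_def split: if_splits\<close>)
  then show ?thesis
    \<comment> \<open>An almost sure property of \<open>X\<close> amounts to one holding
      Lebesgue-almost everywhere where the density is positive.\<close>
    by (subst distributed_AE2[OF X]) simp_all
qed

theorem mainTheorem6:
  fixes M :: "'a measure" and Z :: "nat \<Rightarrow> 'a \<Rightarrow> real" and n :: nat and \<theta> :: real
  assumes "prob_space M"
    and "1 \<le> n"
    and "0 < \<theta>" and "\<theta> < 1"
    and "prob_space.indep_vars M (\<lambda>_. borel) Z {1..n}"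
    and "\<And>i. i \<in> {1..n} \<Longrightarrow> distributed M lborel (Z i) (\<lambda>z. ennreal (pareto_like_density \<theta> z))"
  shows "AE \<omega> in M. is_mle pareto_like_density {0<..<1} n (\<lambda>i. Z i \<omega>)
                       (Min ((\<lambda>i. Z i \<omega>) ` {1..n}))"
proof -
  have "AE \<omega> in M. \<forall>i\<in>{1..n}. 0 < Z i \<omega> \<and> Z i \<omega> < 1"
    using prob_space.AE_pareto_like_density_interior[OF assms(1,6,3)] by (intro AE_finite_allI) auto
  then show ?thesis
    by eventually_elim (rule is_mle_pareto_like_density_Min[OF \<open>1 \<le> n\<close>], blast)
qed

end
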